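(* Take an integer $0\leq m\leq\nu$ such that $p-s_m$ is an integer. For each integer $1\leq j\leq p-s_m$, let $k(j):=\max\{k:\ j\geq s_k-s_m\}$. Let (i) $T:=\{t_1,\ldots,t_a\}\subset\{1,\ldots,m\}$ where $t_1<\cdots<t_a$; (ii) $S:=\{q_1,\ldots,q_s\}\subset\{m+2,\ldots,n\}$ (with $q_1,\dots,q_s$ distinct) where $s=p-s_m$ and $q_j>k(j)$ for all $1\leq j\leq p-s_m$; and (iii) $S$ is chosen so that $a_j=1$ for all $j\in S$, and $a_j\leq s_m$ for all $j\in[n]\setminus S$. Set $t_{a+1}:=m+1$. Let $\alpha_{q_1}:=h_{k(1)+1}-h_{m+1}$, and for $2\leq j\leq p-s_m$ define $$\alpha_{q_j}:=\min\Big\{\alpha_{q_{j-1}},\ h_{k(j)+1}-h_{m+1}-\sum_{i<j,\ q_i>k(j)}\alpha_{q_i}\Big\}.$$ Then $$y+\sum_{j=1}^{a}(h_{t_j}-h_{t_{j+1}})z_{t_j}+\sum_{i\in S}\alpha_iz_i\ \geq\ h_{t_1}+\sum_{i\in S}\alpha_i$$ is a valid inequality for $\mathrm{conv}(\mathcal{Q})$. Furthermore, this inequality is facet-defining for $\mathrm{conv}(\mathcal{Q})$ if and only if $h_{t_1}=h_1$.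
   Context: Let $n\ge 1$ be an integer and $[n]=\{1,\dots,n\}$. Let $h_1\geq h_2\geq\cdots\geq h_n\geq 0$ be reals, let $(a_1,\dots,a_n)\in\mathbb{R}^n$ with $a_j\ge 0$ for all $j$, and let $p\ge 0$ be real, with $a_j\leq p$ for all $j\in[n]$ and $\sum_{j\in[n]}a_j>p$. Define $$\mathcal{Q}:=\Big\{(y,z)\in\mathbb{R}_+\times\{0,1\}^n:\ \sum_{j\in[n]}a_jz_j\leq p,\ \ y+h_jz_j\geq h_j\ \ \forall j\in[n]\Big\},$$ where $\mathbb{R}_+$ denotes the nonnegative reals. For $0\leq k\leq n$ let $s_k:=\sum_{j=1}^{k}a_j$ (so $s_0=0$), and let $\nu:=\max\{k\in\{0,\dots,n\}:\ s_k\leq p\}$ (so $\nu<n$). In the definition of $k(j)$ the maximum is over $k\in\{0,\dots,n\}$. The cardinality of $T$ is denoted by the unsubscripted letter $a$ (not to be confused with the coefficients $a_j$); if $T=\emptyset$, then $a=0$ and $t_1=t_{a+1}=m+1$.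
   Formalization: Added assumption: h_{k(0)+1}=h_{m+1}, where k(0)=max{k: s_k≤s_m} (automatic if a_{m+1}>0). Without it the inequality can be invalid: n=3, h=(3,2,1), a=(1,0,1), p=1, m=1, T=S=∅ gives y≥2, but (1,(1,1,0)) lies in Q. *)

theory Defs
  imports "HOL-Analysis.Analysis"
begin

text \<open>
  The ground set \<open>[n]\<close> is \<open>{1..n}\<close> with \<open>n = CARD('n)\<close>; the data \<open>h, a\<close> are indexed by naturals
  in \<open>{1..n}\<close>. A bijection \<open>e\<close> from \<open>{1..n}\<close> to the index type \<open>'n\<close> names the coordinates, so the
  paper's \<open>z\<^sub>j\<close> is \<open>z $ e j\<close>.
\<close>

definition mixing_knapsack_set ::
  "(nat \<Rightarrow> 'n::finite) \<Rightarrow> (nat \<Rightarrow> real) \<Rightarrow> (nat \<Rightarrow> real) \<Rightarrow> real \<Rightarrow> (real \<times> (real ^ 'n)) set" where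
  "mixing_knapsack_set e h a p =
     {(y, z). 0 \<le> y \<and> (\<forall>i. z $ i \<in> {0, 1}) \<and>
        (\<Sum>j = 1..CARD('n). a j * z $ e j) \<le> p \<and>
        (\<forall>j \<in> {1..CARD('n)}. y + h j * z $ e j \<ge> h j)}"

definition psum :: "(nat \<Rightarrow> real) \<Rightarrow> nat \<Rightarrow> real" where
  "psum a k = (\<Sum>j = 1..k. a j)"

definition nu :: "nat \<Rightarrow> (nat \<Rightarrow> real) \<Rightarrow> real \<Rightarrow> nat" where
  "nu n a p = Max {k \<in> {0..n}. psum a k \<le> p}"

definition kidx :: "nat \<Rightarrow> (nat \<Rightarrow> real) \<Rightarrow> nat \<Rightarrow> nat \<Rightarrow> nat" where
  "kidx n a m j = Max {k \<in> {0..n}. real j \<ge> psum a k - psum a m}"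

text \<open>
  Write \<open>k(j)\<close> for \<open>kidx n a m j\<close>, with \<open>m < n\<close>. If \<open>a (m + 1) > 0\<close> then \<open>k(0) = m\<close>. If \<open>a (m + 1) = 0\<close>, then \<open>k(0) > m\<close>, and the inequality
  can be invalid: for \<open>n = 3\<close>, \<open>h = (3, 2, 1)\<close>, \<open>a = (1, 0, 1)\<close>, \<open>p = 1\<close>, \<open>m = 1\<close>, \<open>T = S = {}\<close> it
  reads \<open>y \<ge> 2\<close>, but \<open>(y, z) = (1, (1, 1, 0))\<close> is feasible. What validity needs is
  \<open>h (k(0) + 1) = h (m + 1)\<close>, which by the next lemma is automatic when \<open>a (m + 1) > 0\<close>.
\<close>

lemma kidx_0_eq:
  assumes nonneg: "\<And>j. j \<in> {1..n} \<Longrightarrow> 0 \<le> a j" and "m < n" and pos: "0 < a (m + 1)"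
  shows "kidx n a m 0 = m"
  unfolding kidx_def
proof (rule Max_eqI)
  fix k assume k: "k \<in> {k \<in> {0..n}. real 0 \<ge> psum a k - psum a m}"
  show "k \<le> m"
  proof (rule ccontr)
    assume "\<not> k \<le> m"
    then have "{1..m + 1} \<subseteq> {1..k}" by auto
    then have "psum a (m + 1) \<le> psum a k"
      unfolding psum_def by (rule sum_mono2[rotated]) (use k nonneg in auto)
    moreover have "psum a (m + 1) = psum a m + a (m + 1)" by (simp add: psum_def)
    ultimately show False using k pos by simp
  qed
qed (use \<open>m < n\<close> in auto)

text \<open>
  An inequality \<open>f x \<ge> d\<close> is given by its left-hand side \<open>f\<close>, which is meant to be linear, and its
  right-hand side \<open>d\<close>.
\<close>

definition valid_ineq :: "('v \<Rightarrow> real) \<Rightarrow> real \<Rightarrow> 'v set \<Rightarrow> bool" where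
  "valid_ineq f d P \<longleftrightarrow> (\<forall>x \<in> P. f x \<ge> d)"

definition facet_defining :: "('v::euclidean_space \<Rightarrow> real) \<Rightarrow> real \<Rightarrow> 'v set \<Rightarrow> bool" where
  "facet_defining f d P \<longleftrightarrow> valid_ineq f d P \<and> {x \<in> P. f x = d} facet_of P"

end

theory Submission
  imports Defs
begin

text \<open>
  Write \<open>s\<^sub>k\<close> for \<open>psum a k\<close>, \<open>k(j)\<close> for \<open>kidx n a m j\<close> and \<open>\<alpha>\<^sub>j\<close> for \<open>\<alpha> (q j)\<close>. The coefficients satisfy
  \<open>0 \<ge> \<alpha>\<^sub>1 \<ge> \<alpha>\<^sub>2 \<ge> \<dots>\<close>, and the recursion says that \<open>\<alpha>\<^sub>j\<close> is the largest value, at most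
  \<open>\<alpha>\<^sub>j\<^sub>-\<^sub>1\<close>, for which the sum of \<open>\<alpha>\<^sub>i\<close> over \<open>i \<le> j\<close> with \<open>q i > k(j)\<close> is at most
  \<open>h (k(j) + 1) - h (m + 1)\<close>.

  Validity (\<open>right_le_left\<close>) needs checking only at points \<open>(y, 1\<^sub>U)\<close> of the set. If \<open>U\<close> misses some
  \<open>t r\<close> with \<open>r \<le> c + 1\<close>, the mixing inequality for \<open>T\<close> suffices, because \<open>\<alpha> \<le> 0\<close>. Otherwise the
  claim is \<open>y - h (m + 1) \<ge>\<close> the sum of \<open>\<alpha>\<^sub>i\<close> over all \<open>i\<close> with \<open>q i \<notin> U\<close>. Let \<open>k\<close> be the least
  index outside \<open>U\<close>, so that \<open>y \<ge> h k\<close>; for \<open>k \<le> m + 1\<close> this is enough. For \<open>k > m + 1\<close>, let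
  \<open>j = \<lceil>s\<^sub>k\<^sub>-\<^sub>1 - s\<^sub>m\<rceil>\<close>; the case \<open>j = 0\<close> is settled by \<open>k0\<close>. The knapsack constraint
  leaves room for at most \<open>s - j\<close> of the items \<open>q i \<ge> k\<close>. Since every \<open>i > j\<close> has
  \<open>q i > k(i) \<ge> k - 1\<close>, at least as many items of \<open>S\<close> are missing from \<open>U\<close> as there are \<open>i \<le> j\<close>
  with \<open>q i \<ge> k\<close>; as \<open>\<alpha>\<close> is decreasing, the latter have the larger sum, and that sum is at most
  \<open>h (k(j) + 1) - h (m + 1) \<le> h k - h (m + 1)\<close>
  (\<open>zeros_sum_le\<close>).

  If \<open>h (t 1) = h 1\<close>, the face has dimension \<open>n\<close>, one less than the hull. Put \<open>w\<^sub>j = (- g\<^sub>j, e\<^sub>j)\<close>, where \<open>g\<^sub>j\<close> is the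
  coefficient of \<open>z\<^sub>j\<close>; these vectors form a basis of the kernel of the left-hand side. A tight point
  \<open>(y, 1\<^sub>U)\<close> equals \<open>(d, 0)\<close>, with \<open>d\<close> the right-hand side, plus the sum of \<open>w\<^sub>j\<close> over \<open>j \<in> U\<close>. So it
  is enough that the differences of these sums, for tight \<open>U\<close>, span every \<open>w\<^sub>j\<close>
  (\<open>tight_differences_generate\<close>). The tight sets used are \<open>S\<close>, \<open>S \<union> {j}\<close> with \<open>j \<notin> S \<union> T\<close>, \<open>{1..<t r} \<union> S\<close>, and
  \<open>{1..k(j')} \<union> S\<close> without \<open>q j\<close> and without those \<open>q i > k(j')\<close> with \<open>i < j'\<close>, where \<open>j' \<le> j\<close> is an
  index at which the second term of the minimum is attained and \<open>\<alpha>\<^sub>j\<^sub>' = \<alpha>\<^sub>j\<close>.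

  If \<open>h (t 1) < h 1\<close>, then \<open>left - right \<ge> (h 1 - h (t 1)) (1 - z\<^sub>1)\<close> holds on the hull, so the face
  also lies in the hyperplane \<open>z\<^sub>1 = 1\<close> and its dimension is too small (\<open>aff_dim_face_less\<close>).
\<close>

section \<open>Preliminaries\<close>

text \<open>
  The vectors in \<open>gen\<close> form a basis of the orthogonal complement of \<open>(1, g)\<close>.
\<close>

lemma aff_dim_hyperplane_generated:
  fixes g :: "real ^ 'n::finite" and F :: "(real \<times> (real ^ 'n)) set"
  assumes F: "F \<subseteq> {x. (1, g) \<bullet> x = b}" and x0: "x0 \<in> F"
    and gen: "\<And>i. (- g $ i, axis i 1) \<in> span ((\<lambda>x. x - x0) ` F)"
  shows "aff_dim F = int CARD('n)"
proof -
  have hyp: "aff_dim {x :: real \<times> (real ^ 'n). (1, g) \<bullet> x = b} = int CARD('n)"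
    by (subst aff_dim_hyperplane) (auto simp: zero_prod_def)
  have "{x. (1, g) \<bullet> x = 0} \<subseteq> span ((\<lambda>x. x - x0) ` F)"
  proof
    fix x :: "real \<times> (real ^ 'n)" assume "x \<in> {x. (1, g) \<bullet> x = 0}"
    then have x: "fst x = - (g \<bullet> snd x)" by (cases x) simp
    have "x = (\<Sum>i\<in>UNIV. snd x $ i *\<^sub>R (- g $ i, axis i 1))"
    proof (rule prod_eqI)
      show "fst x = fst (\<Sum>i\<in>UNIV. snd x $ i *\<^sub>R (- g $ i, axis i 1 :: real ^ 'n))"
        by (simp add: x fst_sum inner_vec_def sum_negf mult.commute)
      show "snd x = snd (\<Sum>i\<in>UNIV. snd x $ i *\<^sub>R (- g $ i, axis i 1 :: real ^ 'n))"
        by (simp add: snd_sum vec_eq_iff axis_def if_distrib cong: if_cong)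
    qed
    also have "\<dots> \<in> span ((\<lambda>x. x - x0) ` F)"
      by (intro span_sum span_scale gen)
    finally show "x \<in> span ((\<lambda>x. x - x0) ` F)" .
  qed
  then have "dim {x. (1 :: real, g) \<bullet> x = 0} \<le> dim (span ((\<lambda>x. x - x0) ` F))"
    by (rule dim_subset)
  then have "dim {x. (1 :: real, g) \<bullet> x = 0} \<le> dim ((\<lambda>x. x - x0) ` F)"
    unfolding dim_span .
  moreover have "dim {x :: real \<times> (real ^ 'n). (1, g) \<bullet> x = 0} = CARD('n)"
    by (subst dim_hyperplane) (auto simp: zero_prod_def)
  moreover have "aff_dim F = int (dim ((\<lambda>x. x - x0) ` F))"
    using x0 by (intro aff_dim_eq_dim_subtract hull_inc)
  ultimately show ?thesis
    using aff_dim_subset[OF F] hyp by simp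
qed

text \<open>
  Exchange argument: pass from \<open>I\<close> to \<open>J\<close> by replacing values at most \<open>v \<le> 0\<close> by no more values,
  each at least \<open>v\<close>.
\<close>

lemma sum_antitone_le_of_card_le:
  fixes f :: "nat \<Rightarrow> real"
  assumes fin: "finite I" "finite J" and card: "card J \<le> card I"
    and f: "\<And>i. i \<in> J - I \<Longrightarrow> v \<le> f i" "\<And>i. i \<in> I - J \<Longrightarrow> f i \<le> v" and "v \<le> 0"
  shows "sum f I \<le> sum f J"
proof -
  have "card I = card (I - J) + card (I \<inter> J)" "card J = card (J - I) + card (I \<inter> J)"
    using fin by (metis card_Diff_subset_Int card_mono finite_Int inf_le1 le_add_diff_inverse2,
        metis card_Diff_subset_Int card_mono finite_Int inf_le1 inf_commute le_add_diff_inverse2)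
  then have c: "card (J - I) \<le> card (I - J)" using card by simp
  have "sum f (I - J) \<le> real (card (I - J)) * v"
    using sum_bounded_above[of "I - J" f v] f by auto
  also have "\<dots> \<le> real (card (J - I)) * v"
    using c \<open>v \<le> 0\<close> by (intro mult_right_mono_neg) auto
  also have "\<dots> \<le> sum f (J - I)"
    using sum_bounded_below[of "J - I" v f] f by auto
  finally have "sum f (I - J) \<le> sum f (J - I)" .
  moreover have "sum f I = sum f (I - J) + sum f (I \<inter> J)" "sum f J = sum f (J - I) + sum f (I \<inter> J)"
    using fin by (metis sum.Int_Diff add.commute, metis sum.Int_Diff add.commute inf_commute)
  ultimately show ?thesis by simp
qed

section \<open>The mixing set with a knapsack constraint\<close>

text \<open>
  The data of the mixing set with a knapsack constraint. The items are \<open>{1..n}\<close>, sorted by decreasing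
  \<open>h\<close>, and no single item exceeds the capacity \<open>p\<close>, while all together do.
\<close>

locale mixing_knapsack =
  fixes n :: nat and e :: "nat \<Rightarrow> 'n::finite" and h a :: "nat \<Rightarrow> real" and p :: real
  assumes n: "n = CARD('n)"
    and e: "bij_betw e {1..n} UNIV"
    and h_decreasing: "1 \<le> i \<Longrightarrow> i \<le> j \<Longrightarrow> j \<le> n \<Longrightarrow> h j \<le> h i"
    and h_nonneg: "0 \<le> h n"
    and a_nonneg: "j \<in> {1..n} \<Longrightarrow> 0 \<le> a j"
    and p_nonneg: "0 \<le> p"
    and a_le_p: "j \<in> {1..n} \<Longrightarrow> a j \<le> p"
    and sum_gt_p: "(\<Sum>j = 1..n. a j) > p"
begin

abbreviation Q :: "(real \<times> (real ^ 'n)) set" where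
  "Q \<equiv> mixing_knapsack_set e h a p"

text \<open>
  The 0/1 vector of a set \<open>U \<subseteq> {1..n}\<close> of indices, with coordinates named by \<open>e\<close>.
\<close>

definition ones :: "nat set \<Rightarrow> real ^ 'n" where
  "ones U = (\<Sum>j\<in>U. axis (e j) 1)"

lemma n_pos: "1 \<le> n"
  using n by (simp add: Suc_leI)

lemma h_ge_0: "j \<in> {1..n} \<Longrightarrow> 0 \<le> h j"
  using h_decreasing[of j n] h_nonneg by auto

lemma e_eq_iff: "i \<in> {1..n} \<Longrightarrow> j \<in> {1..n} \<Longrightarrow> e i = e j \<longleftrightarrow> i = j"
  using e by (meson bij_betw_def inj_on_def)

lemma ones_nth:
  assumes "U \<subseteq> {1..n}" "j \<in> {1..n}"
  shows "ones U $ e j = (if j \<in> U then 1 else 0)"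
proof -
  have "ones U $ e j = (\<Sum>i\<in>U. if i = j then 1 else 0)"
    unfolding ones_def sum_component
    using assms by (intro sum.cong) (auto simp: axis_def e_eq_iff subset_iff)
  also have "\<dots> = (if j \<in> U then 1 else 0)"
    using finite_subset[OF assms(1)] by simp
  finally show ?thesis .
qed

lemma point_mem:
  assumes U: "U \<subseteq> {1..n}"
  shows "(y, ones U) \<in> Q \<longleftrightarrow> 0 \<le> y \<and> sum a U \<le> p \<and> (\<forall>j\<in>{1..n} - U. h j \<le> y)"
proof -
  have "ones U $ i \<in> {0, 1}" for i
  proof -
    obtain j where "j \<in> {1..n}" "i = e j"
      using e by (metis UNIV_I bij_betw_imp_surj_on imageE)
    then show ?thesis using U by (simp add: ones_nth)
  qed
  moreover have "(\<Sum>j = 1..n. a j * ones U $ e j) = sum a U"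
  proof -
    have "(\<Sum>j = 1..n. a j * ones U $ e j) = (\<Sum>j\<in>{1..n}. if j \<in> U then a j else 0)"
      using U by (intro sum.cong) (auto simp: ones_nth)
    also have "\<dots> = sum a ({1..n} \<inter> U)"
      by (simp add: sum.inter_restrict)
    also have "{1..n} \<inter> U = U" using U by auto
    finally show ?thesis .
  qed
  moreover have "(\<forall>j\<in>{1..n}. y + h j * ones U $ e j \<ge> h j) \<longleftrightarrow> (\<forall>j\<in>{1..n} - U. h j \<le> y)" if "0 \<le> y"
    using U that by (auto simp: ones_nth)
  ultimately show ?thesis
    unfolding mixing_knapsack_set_def n[symmetric] by auto
qed

lemma mem_obtains_ones:
  assumes "x \<in> Q"
  obtains y U where "x = (y, ones U)" "U \<subseteq> {1..n}"
proof -
  obtain y z where x: "x = (y, z)" by (cases x)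
  have z: "z $ i \<in> {0, 1}" for i
    using assms by (auto simp: x mixing_knapsack_set_def)
  define U where "U = {j \<in> {1..n}. z $ e j = 1}"
  then have U: "U \<subseteq> {1..n}" by blast
  have "z = ones U"
  proof (rule vec_eq_iff[THEN iffD2, rule_format])
    fix i
    obtain j where "j \<in> {1..n}" "i = e j"
      using e by (metis UNIV_I bij_betw_imp_surj_on imageE)
    then show "z $ i = ones U $ i"
      using z[of "e j"] ones_nth[of U j] U by (auto simp: U_def)
  qed
  then show thesis using that x U by blast
qed

text \<open>
  Differences of the points \<open>(h 1, 0)\<close>, \<open>(h 1 + 1, 0)\<close> and \<open>(h 1, e\<^sub>j)\<close> give the standard basis; the last
  kind is feasible because \<open>a j \<le> p\<close>.
\<close>

lemma aff_dim_convex_hull_Q: "aff_dim (convex hull Q) = int CARD('n) + 1"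
proof -
  let ?V = "span ((\<lambda>x. x - (h 1, 0)) ` Q)"
  have h1: "h j \<le> h 1" if "j \<in> {1..n}" for j
    using that h_decreasing[of 1 j] by auto
  have mem: "(y, ones {}) \<in> Q" if "h 1 \<le> y" for y
    using that h1 h_ge_0[of 1] n_pos p_nonneg by (subst point_mem) force+
  then have x0: "(h 1, 0) \<in> Q" by (simp add: ones_def)
  have 1: "(1, 0) \<in> ?V"
  proof -
    have "(h 1 + 1, 0) - (h 1, 0) \<in> ?V"
      using mem[of "h 1 + 1"] by (intro span_base imageI) (simp add: ones_def)
    then show ?thesis by simp
  qed
  have 2: "(0, axis i 1) \<in> ?V" for i
  proof -
    obtain j where j: "j \<in> {1..n}" "i = e j"
      using e by (metis UNIV_I bij_betw_imp_surj_on imageE)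
    have "(h 1, ones {j}) \<in> Q"
      using j h1 h_ge_0[of 1] n_pos a_le_p by (subst point_mem) force+
    then have "(h 1, ones {j}) - (h 1, 0) \<in> ?V"
      by (intro span_base imageI)
    then show ?thesis by (simp add: ones_def j)
  qed
  have "Basis \<subseteq> ?V"
    using 1 2 by (auto simp: Basis_prod_def Basis_vec_def)
  then have "?V = UNIV"
    by (metis span_Basis span_mono span_span top.extremum_uniqueI)
  then have "dim ((\<lambda>x. x - (h 1, 0)) ` Q) = DIM(real \<times> (real ^ 'n))"
    by (metis dim_span dim_UNIV)
  moreover have "aff_dim Q = int (dim ((\<lambda>x. x - (h 1, 0)) ` Q))"
    using x0 by (intro aff_dim_eq_dim_subtract hull_inc)
  ultimately show ?thesis by (simp add: aff_dim_convex_hull)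
qed

lemma psum_mono: "i \<le> j \<Longrightarrow> j \<le> n \<Longrightarrow> psum a i \<le> psum a j"
  unfolding psum_def by (rule sum_mono2) (auto intro: a_nonneg)

end

section \<open>The inequality and its coefficients\<close>

text \<open>
  The parameters of the inequality: \<open>t 1 < \<dots> < t c\<close> enumerate \<open>T\<close>, \<open>q\<close> enumerates \<open>S\<close>, and \<open>s\<close> is the
  capacity left by the first \<open>m\<close> items. The assumption \<open>k0\<close> covers \<open>a (m + 1) = 0\<close>, where the index
  \<open>k(0)\<close> exceeds \<open>m\<close>.
\<close>

locale lifted_mixing = mixing_knapsack n e h a p
  for n and e :: "nat \<Rightarrow> 'n::finite" and h a :: "nat \<Rightarrow> real" and p :: real +
  fixes m s c :: nat and t q :: "nat \<Rightarrow> nat" and S :: "nat set" and \<alpha> :: "nat \<Rightarrow> real"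
  assumes m_le_nu: "m \<le> nu n a p"
    and k0: "h (kidx n a m 0 + 1) = h (m + 1)"
    and t_range: "t ` {1..c} \<subseteq> {1..m}" and t_mono: "strict_mono_on {1..c} t"
    and t_last: "t (c + 1) = m + 1"
    and s: "real s = p - psum a m"
    and S: "S = q ` {1..s}" "S \<subseteq> {m + 2..n}" "inj_on q {1..s}"
    and q_gt: "j \<in> {1..s} \<Longrightarrow> q j > kidx n a m j"
    and a_S: "j \<in> S \<Longrightarrow> a j = 1"
    and a_not_S: "j \<in> {1..n} - S \<Longrightarrow> a j \<le> psum a m"
    and alpha_first: "1 \<le> s \<Longrightarrow> \<alpha> (q 1) = h (kidx n a m 1 + 1) - h (m + 1)"
    and alpha_next: "2 \<le> j \<Longrightarrow> j \<le> s \<Longrightarrow>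
      \<alpha> (q j) = min (\<alpha> (q (j - 1)))
        (h (kidx n a m j + 1) - h (m + 1)
          - (\<Sum>i | i \<in> {1..<j} \<and> q i > kidx n a m j. \<alpha> (q i)))"
begin

abbreviation K :: "nat \<Rightarrow> nat" where
  "K \<equiv> kidx n a m"

text \<open>
  Both sides of the inequality \<open>left_side (y, z) \<ge> right_side\<close>.
\<close>

definition left_side :: "real \<times> (real ^ 'n) \<Rightarrow> real" where
  "left_side = (\<lambda>(y, z). y + (\<Sum>j = 1..c. (h (t j) - h (t (j + 1))) * z $ e (t j))
                 + (\<Sum>i \<in> S. \<alpha> i * z $ e i))"

definition right_side :: real where
  "right_side = h (t 1) + (\<Sum>i \<in> S. \<alpha> i)"

lemma m_less_n: "m < n"
proof -
  have ne: "{k \<in> {0..n}. psum a k \<le> p} \<noteq> {}"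
    using p_nonneg by (auto simp: psum_def intro: exI[of _ 0])
  have "nu n a p \<in> {k \<in> {0..n}. psum a k \<le> p}"
    unfolding nu_def by (rule Max_in[OF _ ne]) auto
  moreover have "psum a n > p" using sum_gt_p by (simp add: psum_def)
  ultimately have "nu n a p < n" by (auto simp: le_less)
  then show ?thesis using m_le_nu by simp
qed

lemma K_mem: "K j \<in> {k \<in> {0..n}. real j \<ge> psum a k - psum a m}"
  unfolding kidx_def
proof (rule Max_in)
  have "m \<in> {k \<in> {0..n}. real j \<ge> psum a k - psum a m}" using m_less_n by auto
  then show "{k \<in> {0..n}. real j \<ge> psum a k - psum a m} \<noteq> {}" by blast
qed auto

lemma psum_K_le: "psum a (K j) \<le> psum a m + real j"
  using K_mem[of j] by auto

lemma K_greatest: "k \<le> n \<Longrightarrow> psum a k \<le> psum a m + real j \<Longrightarrow> k \<le> K j"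
  unfolding kidx_def by (rule Max_ge) auto

lemma K_less: "j \<le> s \<Longrightarrow> K j < n"
proof -
  assume "j \<le> s"
  then have "psum a (K j) \<le> p" using psum_K_le[of j] s by linarith
  moreover have "psum a n > p" using sum_gt_p by (simp add: psum_def)
  ultimately show "K j < n" using K_mem[of j] by (auto simp: le_less)
qed

lemma m_le_K: "m \<le> K j"
  using m_less_n by (intro K_greatest) auto

lemma K_mono: "i \<le> j \<Longrightarrow> K i \<le> K j"
  using K_mem[of i] psum_K_le[of i] by (intro K_greatest) auto

lemma q_mem: "j \<in> {1..s} \<Longrightarrow> q j \<in> {m + 2..n}"
  using S by blast

lemma t_mem_m: "j \<in> {1..c} \<Longrightarrow> t j \<in> {1..m}"
  using t_range by blast

lemma psum_m_nonneg: "0 \<le> psum a m"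
  using psum_mono[of 0 m] m_less_n by (simp add: psum_def)

lemma t_less: "i < j \<Longrightarrow> 1 \<le> i \<Longrightarrow> j \<le> c + 1 \<Longrightarrow> t i < t j"
proof (cases "j = c + 1")
  case True
  assume "i < j" "1 \<le> i"
  then have "t i \<in> {1..m}" using t_mem_m[of i] True by auto
  then show ?thesis using True t_last by simp
next
  case False
  assume "i < j" "1 \<le> i" "j \<le> c + 1"
  then show ?thesis using False t_mono by (auto simp: strict_mono_on_def)
qed

lemma t_mem: "1 \<le> j \<Longrightarrow> j \<le> c + 1 \<Longrightarrow> t j \<in> {1..m + 1}"
  using t_mem_m[of j] t_last by (cases "j = c + 1") auto

lemma h_t_diff_nonneg: "j \<in> {1..c} \<Longrightarrow> 0 \<le> h (t j) - h (t (j + 1))"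
  using t_less[of j "j + 1"] t_mem[of j] t_mem[of "j + 1"] m_less_n
  by (auto intro!: h_decreasing)

lemma t_telescope: "1 \<le> r \<Longrightarrow> (\<Sum>j = 1..<r. h (t j) - h (t (j + 1))) = h (t 1) - h (t r)"
  by (induction r rule: nat_induct_at_least) auto

lemma alpha_antimono: "1 \<le> i \<Longrightarrow> i \<le> j \<Longrightarrow> j \<le> s \<Longrightarrow> \<alpha> (q j) \<le> \<alpha> (q i)"
proof (induction j)
  case (Suc j)
  show ?case
  proof (cases "i = Suc j")
    case False
    then have "\<alpha> (q (Suc j)) \<le> \<alpha> (q j)" using Suc.prems alpha_next[of "Suc j"] by simp
    also have "\<dots> \<le> \<alpha> (q i)" using Suc False by simp
    finally show ?thesis .
  qed simp
qed simp

lemma alpha_nonpos: "j \<in> {1..s} \<Longrightarrow> \<alpha> (q j) \<le> 0"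
proof -
  assume j: "j \<in> {1..s}"
  then have "\<alpha> (q j) \<le> \<alpha> (q 1)" by (intro alpha_antimono) auto
  also have "\<dots> = h (K 1 + 1) - h (m + 1)" using j alpha_first by simp
  also have "\<dots> \<le> 0" using m_le_K[of 1] K_less[of 1] j by (auto intro!: h_decreasing)
  finally show ?thesis .
qed

lemma alpha_sum_le:
  assumes "j \<in> {1..s}"
  shows "(\<Sum>i | i \<in> {1..j} \<and> q i > K j. \<alpha> (q i)) \<le> h (K j + 1) - h (m + 1)"
proof -
  have "{i. i \<in> {1..j} \<and> q i > K j} = insert j {i. i \<in> {1..<j} \<and> q i > K j}"
    using assms q_gt[of j] by auto
  then have "(\<Sum>i | i \<in> {1..j} \<and> q i > K j. \<alpha> (q i))
      = \<alpha> (q j) + (\<Sum>i | i \<in> {1..<j} \<and> q i > K j. \<alpha> (q i))"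
    by simp
  also have "\<dots> \<le> h (K j + 1) - h (m + 1)"
  proof (cases "j = 1")
    case True
    then show ?thesis using alpha_first assms by simp
  next
    case False
    then show ?thesis using alpha_next[of j] assms by simp
  qed
  finally show ?thesis .
qed

text \<open>
  As long as the minimum is the previous coefficient, nothing changes; so at some \<open>j' \<le> j\<close> with
  \<open>\<alpha> (q j') = \<alpha> (q j)\<close> the second term of the minimum is attained.
\<close>

lemma alpha_sum_attained:
  assumes "j \<in> {1..s}"
  shows "\<exists>j'\<in>{1..j}. \<alpha> (q j) + (\<Sum>i | i \<in> {1..<j'} \<and> q i > K j'. \<alpha> (q i)) = h (K j' + 1) - h (m + 1)"
  using assms
proof (induction j)
  case (Suc j)
  consider "Suc j = 1" | "1 \<le> j" "\<alpha> (q (Suc j)) = \<alpha> (q j)"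
    | "\<alpha> (q (Suc j)) = h (K (Suc j) + 1) - h (m + 1)
          - (\<Sum>i | i \<in> {1..<Suc j} \<and> q i > K (Suc j). \<alpha> (q i))"
    using alpha_next[of "Suc j"] Suc.prems by (fastforce simp: min_def split: if_splits)
  then show ?case
  proof cases
    case 1
    then show ?thesis using alpha_first Suc.prems by (intro bexI[of _ 1]) auto
  next
    case 2
    then obtain j' where "j' \<in> {1..j}"
      "\<alpha> (q j) + (\<Sum>i | i \<in> {1..<j'} \<and> q i > K j'. \<alpha> (q i)) = h (K j' + 1) - h (m + 1)"
      using Suc by auto
    then show ?thesis using 2 by (intro bexI[of _ j']) auto
  next
    case 3
    then show ?thesis by (intro bexI[of _ "Suc j"]) auto
  qed
qed simp

text \<open>
  The items of \<open>S\<close> missing from \<open>U\<close>, represented by their positions in the enumeration \<open>q\<close>.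
\<close>

definition zeros :: "nat set \<Rightarrow> nat set" where
  "zeros U = {i \<in> {1..s}. q i \<notin> U}"

lemma left_minus_right:
  assumes U: "U \<subseteq> {1..n}"
  shows "left_side (y, ones U) - right_side =
    y + (\<Sum>j | j \<in> {1..c} \<and> t j \<in> U. h (t j) - h (t (j + 1))) - h (t 1) - (\<Sum>i\<in>zeros U. \<alpha> (q i))"
proof -
  have "(\<Sum>j = 1..c. (h (t j) - h (t (j + 1))) * ones U $ e (t j))
      = (\<Sum>j = 1..c. if t j \<in> U then h (t j) - h (t (j + 1)) else 0)"
  proof (rule sum.cong[OF refl])
    fix j assume "j \<in> {1..c}"
    then have "t j \<in> {1..n}" using t_mem[of j] m_less_n by auto
    then show "(h (t j) - h (t (j + 1))) * ones U $ e (t j)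
        = (if t j \<in> U then h (t j) - h (t (j + 1)) else 0)"
      using U by (simp add: ones_nth)
  qed
  also have "\<dots> = (\<Sum>j | j \<in> {1..c} \<and> t j \<in> U. h (t j) - h (t (j + 1)))"
    by (rule sum.inter_filter[symmetric, THEN trans]) (auto intro: sum.cong)
  finally have 1: "(\<Sum>j = 1..c. (h (t j) - h (t (j + 1))) * ones U $ e (t j))
      = (\<Sum>j | j \<in> {1..c} \<and> t j \<in> U. h (t j) - h (t (j + 1)))" .
  have "(\<Sum>i\<in>S. \<alpha> i) - (\<Sum>i\<in>S. \<alpha> i * ones U $ e i) = (\<Sum>i\<in>S. if i \<notin> U then \<alpha> i else 0)"
    unfolding sum_subtractf[symmetric] using S(2) U
    by (intro sum.cong) (auto simp: ones_nth subset_iff)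
  also have "\<dots> = (\<Sum>i\<in>{1..s}. if q i \<notin> U then \<alpha> (q i) else 0)"
    unfolding S(1) by (rule sum.reindex_cong[OF S(3)]) auto
  also have "\<dots> = (\<Sum>i\<in>zeros U. \<alpha> (q i))"
    unfolding zeros_def by (rule sum.inter_filter[symmetric]) auto
  finally show ?thesis
    using 1 unfolding left_side_def right_side_def by simp
qed

section \<open>Validity\<close>

text \<open>
  The classical mixing inequality: up to the first missing \<open>t r\<close> the coefficients telescope to
  \<open>h (t 1) - h (t r)\<close>, and \<open>y \<ge> h (t r)\<close>.
\<close>

lemma mixing_ineq:
  assumes U: "U \<subseteq> {1..n}" and mem: "(y, ones U) \<in> Q"
    and r: "1 \<le> r" "r \<le> c + 1" "t r \<notin> U"
  shows "h (t 1) \<le> y + (\<Sum>j | j \<in> {1..c} \<and> t j \<in> U. h (t j) - h (t (j + 1)))"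
proof -
  define r' where "r' = (LEAST r. 1 \<le> r \<and> t r \<notin> U)"
  have r': "1 \<le> r' \<and> t r' \<notin> U"
    unfolding r'_def by (rule LeastI[of _ r]) (use r in simp)
  have "r' \<le> r" unfolding r'_def by (rule Least_le) (use r in simp)
  have less: "t j \<in> U" if "1 \<le> j" "j < r'" for j
    using not_less_Least[of j "\<lambda>r. 1 \<le> r \<and> t r \<notin> U"] that unfolding r'_def by blast
  have "h (t r') \<le> y"
    using mem r' t_mem[of r'] \<open>r' \<le> r\<close> r m_less_n unfolding point_mem[OF U] by auto
  moreover have "(\<Sum>j = 1..<r'. h (t j) - h (t (j + 1)))
      \<le> (\<Sum>j | j \<in> {1..c} \<and> t j \<in> U. h (t j) - h (t (j + 1)))"
    using less \<open>r' \<le> r\<close> r by (intro sum_mono2) (auto intro: h_t_diff_nonneg[simplified])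
  ultimately show ?thesis using t_telescope[of r'] r' by simp
qed

text \<open>
  The core of validity: if \<open>U\<close> contains all items below \<open>k\<close>, then the knapsack constraint forces so many
  items of \<open>S\<close> out of \<open>U\<close> that their coefficients compensate for the drop from \<open>h (m + 1)\<close> to \<open>h k\<close>.
\<close>

lemma zeros_sum_le:
  assumes U: "U \<subseteq> {1..n}" and weight: "sum a U \<le> p"
    and k: "m + 1 < k" "k \<le> n" "{1..<k} \<subseteq> U"
  shows "(\<Sum>i\<in>zeros U. \<alpha> (q i)) \<le> h k - h (m + 1)"
proof -
  define j where "j = nat \<lceil>psum a (k - 1) - psum a m\<rceil>"
  have finU: "finite U" using U finite_subset by blast
  have j_ge: "psum a (k - 1) \<le> psum a m + real j"
    unfolding j_def by linarith
  then have kK: "k - 1 \<le> K j" using k by (intro K_greatest) auto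
  define R where "R = {i \<in> {1..s}. k \<le> q i \<and> q i \<in> U}"
  have "real (card R) + psum a (k - 1) \<le> p"
  proof -
    have inj: "inj_on q R" using S(3) by (rule inj_on_subset) (auto simp: R_def)
    have "sum a (q ` R) = (\<Sum>i\<in>q ` R. 1)"
      by (rule sum.cong) (use a_S S(1) in \<open>auto simp: R_def\<close>)
    then have "sum a (q ` R) = real (card R)"
      by (simp add: card_image[OF inj])
    moreover have "sum a ({1..k - 1} \<union> q ` R) = sum a {1..k - 1} + sum a (q ` R)"
      using k by (intro sum.union_disjoint) (auto simp: R_def)
    moreover have "sum a ({1..k - 1} \<union> q ` R) \<le> sum a U"
      using k finU U a_nonneg by (intro sum_mono2) (auto simp: R_def subset_iff)
    ultimately show ?thesis using weight by (simp add: psum_def)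
  qed
  then have "psum a (k - 1) - psum a m \<le> real_of_int (int s - int (card R))"
    using s by simp
  \<comment> \<open>The right-hand side is an integer, so the bound survives rounding up to \<open>j\<close>.\<close>
  then have ceil: "\<lceil>psum a (k - 1) - psum a m\<rceil> \<le> int s - int (card R)"
    by (simp add: ceiling_le_iff)
  have "psum a m \<le> psum a (k - 1)" using k by (intro psum_mono) auto
  then have jR: "j + card R \<le> s" using ceil unfolding j_def by linarith
  show ?thesis
  proof (cases "j = 0")
    case True
    \<comment> \<open>Items \<open>m + 1\<close> to \<open>k - 1\<close> have weight 0, so \<open>h\<close> is constant on \<open>{m + 1..k}\<close> by \<open>k0\<close>.\<close>
    have "h (m + 1) = h (K 0 + 1)" using k0 by simp
    also have "\<dots> \<le> h k"
      using kK True k K_less[of 0] by (intro h_decreasing) auto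
    finally have "h (m + 1) \<le> h k" .
    moreover have "(\<Sum>i\<in>zeros U. \<alpha> (q i)) \<le> 0"
      by (intro sum_nonpos) (auto simp: zeros_def intro: alpha_nonpos)
    ultimately show ?thesis by simp
  next
    case False
    \<comment> \<open>Every item that comes late in the enumeration lies beyond the prefix, hence \<open>J\<close> misses exactly
      \<open>s - j\<close> of the items \<open>q i \<ge> k\<close>, and at most that many of them are in \<open>U\<close>.\<close>
    define J where "J = {i \<in> {1..j}. k \<le> q i}"
    have late: "k \<le> q i" if "i \<in> {j..s}" "i \<ge> 1" for i
      using q_gt[of i] K_mono[of j i] kK that by auto
    have zeros_ge: "k \<le> q i" if "i \<in> zeros U" for i
    proof (rule ccontr)
      assume "\<not> k \<le> q i"
      then have "q i \<in> {1..<k}" using q_mem[of i] that by (auto simp: zeros_def)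
      then show False using that k(3) by (auto simp: zeros_def)
    qed
    have "card J \<le> card (zeros U)"
    proof -
      have "zeros U \<union> R = {i \<in> {1..s}. k \<le> q i}"
        using zeros_ge by (auto simp: zeros_def R_def)
      also have "\<dots> = J \<union> {j<..s}"
        using late jR by (auto simp: J_def)
      finally have "J \<union> {j<..s} = zeros U \<union> R" by simp
      moreover have "card (J \<union> {j<..s}) = card J + (s - j)"
        by (subst card_Un_disjoint) (auto simp: J_def)
      moreover have "card (zeros U \<union> R) = card (zeros U) + card R"
        by (subst card_Un_disjoint) (auto simp: zeros_def R_def)
      ultimately show ?thesis using jR by simp
    qed
    moreover have "i \<in> J" if "i \<le> j" "i \<in> zeros U" for i
      using zeros_ge[OF that(2)] that by (auto simp: J_def zeros_def)
    then have "j \<le> i" if "i \<in> zeros U - J" for i using that by (metis Diff_iff nat_le_linear)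
    ultimately have "(\<Sum>i\<in>zeros U. \<alpha> (q i)) \<le> (\<Sum>i\<in>J. \<alpha> (q i))"
      using False jR
      by (intro sum_antitone_le_of_card_le[where v = "\<alpha> (q j)"] alpha_antimono alpha_nonpos)
        (auto simp: J_def zeros_def)
    also have "\<dots> \<le> (\<Sum>i | i \<in> {1..j} \<and> q i > K j. \<alpha> (q i))"
    proof -
      have "{i. i \<in> {1..j} \<and> q i > K j} \<subseteq> J" using kK by (auto simp: J_def)
      moreover have "\<alpha> (q i) \<le> 0" if "i \<in> J" for i
        using that jR by (intro alpha_nonpos) (auto simp: J_def)
      ultimately have "(\<Sum>i | i \<in> {1..j} \<and> q i > K j. - \<alpha> (q i)) \<le> (\<Sum>i\<in>J. - \<alpha> (q i))"
        by (intro sum_mono2) (auto simp: J_def)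
      then show ?thesis by (simp add: sum_negf)
    qed
    also have "\<dots> \<le> h (K j + 1) - h (m + 1)"
      using False jR by (intro alpha_sum_le) auto
    also have "\<dots> \<le> h k - h (m + 1)"
      using kK k K_less[of j] jR by (auto intro!: h_decreasing)
    finally show ?thesis .
  qed
qed

lemma right_le_left_point:
  assumes U: "U \<subseteq> {1..n}" and mem: "(y, ones U) \<in> Q"
  shows "right_side \<le> left_side (y, ones U)"
proof (cases "\<exists>r. 1 \<le> r \<and> r \<le> c + 1 \<and> t r \<notin> U")
  case True
  then have "h (t 1) \<le> y + (\<Sum>j | j \<in> {1..c} \<and> t j \<in> U. h (t j) - h (t (j + 1)))"
    using mixing_ineq[OF U mem] by blast
  moreover have "(\<Sum>i\<in>zeros U. \<alpha> (q i)) \<le> 0"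
    by (intro sum_nonpos) (auto simp: zeros_def intro: alpha_nonpos)
  ultimately show ?thesis using left_minus_right[OF U, of y] by simp
next
  case False
  then have "{j. j \<in> {1..c} \<and> t j \<in> U} = {1..<c + 1}" by force
  then have sum: "(\<Sum>j | j \<in> {1..c} \<and> t j \<in> U. h (t j) - h (t (j + 1))) = h (t 1) - h (m + 1)"
    using t_telescope[of "c + 1"] t_last by simp
  have weight: "sum a U \<le> p" and y: "\<And>j. j \<in> {1..n} - U \<Longrightarrow> h j \<le> y"
    using mem unfolding point_mem[OF U] by auto
  have "\<not> {1..n} \<subseteq> U"
    using U weight sum_gt_p by (metis not_le subset_antisym)
  then have ex: "\<exists>k. k \<in> {1..n} - U" by blast
  define k where "k = (LEAST k. k \<in> {1..n} - U)"
  have k: "k \<in> {1..n} - U" unfolding k_def using ex by (rule LeastI_ex)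
  have less: "{1..<k} \<subseteq> U"
    using not_less_Least[of _ "\<lambda>k. k \<in> {1..n} - U"] k unfolding k_def[symmetric] by force
  have "y - h (m + 1) - (\<Sum>i\<in>zeros U. \<alpha> (q i)) \<ge> 0"
  proof (cases "k \<le> m + 1")
    case True
    then have "h (m + 1) \<le> h k" using k m_less_n by (intro h_decreasing) auto
    moreover have "(\<Sum>i\<in>zeros U. \<alpha> (q i)) \<le> 0"
      by (intro sum_nonpos) (auto simp: zeros_def intro: alpha_nonpos)
    ultimately show ?thesis using y[OF k] by simp
  next
    case False
    then show ?thesis using zeros_sum_le[OF U weight, of k] k less y[OF k] by simp
  qed
  then show ?thesis using left_minus_right[OF U, of y] sum by simp
qed

text \<open>
  Leaving out item 1 forces \<open>y \<ge> h 1\<close>, so such a point is never tight when \<open>h (t 1) < h 1\<close>.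
\<close>

lemma first_zero_slack:
  assumes U: "U \<subseteq> {1..n}" and mem: "(y, ones U) \<in> Q" and "1 \<notin> U"
  shows "h 1 - h (t 1) \<le> left_side (y, ones U) - right_side"
proof -
  have "h 1 \<le> y" using mem \<open>1 \<notin> U\<close> n_pos unfolding point_mem[OF U] by auto
  moreover have "0 \<le> (\<Sum>j | j \<in> {1..c} \<and> t j \<in> U. h (t j) - h (t (j + 1)))"
    by (intro sum_nonneg) (auto intro: h_t_diff_nonneg[simplified])
  moreover have "(\<Sum>i\<in>zeros U. \<alpha> (q i)) \<le> 0"
    by (intro sum_nonpos) (auto simp: zeros_def intro: alpha_nonpos)
  ultimately show ?thesis using left_minus_right[OF U, of y] by simp
qed

text \<open>
  The coefficient vector of \<open>z\<close> in \<open>left_side\<close>.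
\<close>

definition z_normal :: "real ^ 'n" where
  "z_normal = (\<Sum>j = 1..c. (h (t j) - h (t (j + 1))) *\<^sub>R axis (e (t j)) 1)
     + (\<Sum>i\<in>S. \<alpha> i *\<^sub>R axis (e i) 1)"

lemma left_side_inner: "left_side x = (1, z_normal) \<bullet> x"
  by (cases x)
    (simp add: left_side_def z_normal_def inner_add_left inner_sum_left inner_axis')

lemma right_le_left:
  assumes "x \<in> convex hull Q"
  shows "right_side \<le> left_side x"
proof -
  have "convex hull Q \<subseteq> {x. (1, z_normal) \<bullet> x \<ge> right_side}"
  proof (rule hull_minimal)
    show "Q \<subseteq> {x. (1, z_normal) \<bullet> x \<ge> right_side}"
    proof
      fix x assume "x \<in> Q"
      then obtain y U where "x = (y, ones U)" "U \<subseteq> {1..n}" by (rule mem_obtains_ones)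
      then show "x \<in> {x. (1, z_normal) \<bullet> x \<ge> right_side}"
        using right_le_left_point[of U y] \<open>x \<in> Q\<close> left_side_inner[of x] by simp
    qed
  qed (rule convex_halfspace_ge)
  then show ?thesis using assms left_side_inner by auto
qed

section \<open>Tight points and the facet property\<close>

text \<open>
  The supports \<open>U\<close> of the 0/1 points at which the inequality holds with equality for some feasible \<open>y\<close>.
\<close>

definition tight :: "nat set \<Rightarrow> bool" where
  "tight U \<longleftrightarrow> U \<subseteq> {1..n} \<and> (\<exists>y. (y, ones U) \<in> Q \<and> left_side (y, ones U) = right_side)"

text \<open>
  The tight sets used below, except \<open>S \<union> {j}\<close>, consist of a prefix \<open>{1..k}\<close> and of \<open>S\<close> without some
  items beyond \<open>k\<close>; the point has \<open>y = h (k + 1)\<close>.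
\<close>

lemma tight_prefix:
  assumes k: "k < n" and I: "I \<subseteq> {1..s}" "\<And>i. i \<in> I \<Longrightarrow> k < q i"
    and weight: "psum a k + real (card {i \<in> {1..s}. k < q i \<and> i \<notin> I}) \<le> p"
    and height: "h (k + 1) + (\<Sum>j | j \<in> {1..c} \<and> t j \<le> k. h (t j) - h (t (j + 1)))
      = h (t 1) + (\<Sum>i\<in>I. \<alpha> (q i))"
  shows "tight ({1..k} \<union> q ` ({1..s} - I))"
proof -
  let ?U = "{1..k} \<union> q ` ({1..s} - I)"
  let ?R = "{i \<in> {1..s}. k < q i \<and> i \<notin> I}"
  have U: "?U \<subseteq> {1..n}" using k q_mem by fastforce
  have "?U = {1..k} \<union> q ` ?R" using q_mem by fastforce
  moreover have "sum a ({1..k} \<union> q ` ?R) = sum a {1..k} + sum a (q ` ?R)"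
    by (intro sum.union_disjoint) auto
  moreover have "sum a (q ` ?R) = real (card ?R)"
  proof -
    have "inj_on q ?R" using S(3) by (rule inj_on_subset) auto
    moreover have "sum a (q ` ?R) = (\<Sum>i\<in>q ` ?R. 1)"
      by (rule sum.cong) (use a_S S(1) in auto)
    ultimately show ?thesis by (simp add: card_image)
  qed
  ultimately have "sum a ?U \<le> p" using weight by (simp add: psum_def)
  moreover have "h j \<le> h (k + 1)" if "j \<in> {1..n} - ?U" for j
    using that by (intro h_decreasing) auto
  ultimately have mem: "(h (k + 1), ones ?U) \<in> Q"
    using h_ge_0[of "k + 1"] k by (subst point_mem[OF U]) auto
  have zeros: "zeros ?U = I"
  proof (intro set_eqI iffI)
    fix i assume "i \<in> I"
    then have "i \<in> {1..s}" "k < q i" using I by auto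
    moreover have "q i \<notin> q ` ({1..s} - I)"
      using \<open>i \<in> I\<close> \<open>i \<in> {1..s}\<close> inj_on_image_mem_iff[OF S(3), of i "{1..s} - I"] by auto
    ultimately show "i \<in> zeros ?U" by (auto simp: zeros_def)
  qed (auto simp: zeros_def)
  have "{j. j \<in> {1..c} \<and> t j \<in> ?U} = {j. j \<in> {1..c} \<and> t j \<le> k}"
    using t_mem_m q_mem by fastforce
  then have "left_side (h (k + 1), ones ?U) = right_side"
    using left_minus_right[OF U, of "h (k + 1)"] height zeros by simp
  then show ?thesis using U mem by (auto simp: tight_def)
qed

lemma card_q_greater_le: "real (card {i \<in> {1..s}. k < q i \<and> i \<notin> {}}) \<le> real s"
  using card_mono[of "{1..s}" "{i \<in> {1..s}. k < q i \<and> i \<notin> {}}"] by fastforce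

lemma tight_prefix_t:
  assumes r: "1 \<le> r" "r \<le> c + 1"
  shows "tight ({1..<t r} \<union> S)"
proof -
  have tr: "t r \<in> {1..m + 1}" using t_mem r by simp
  have "psum a (t r - 1) \<le> psum a m" using tr m_less_n by (intro psum_mono) auto
  then have "psum a (t r - 1) + real (card {i \<in> {1..s}. t r - 1 < q i \<and> i \<notin> {}}) \<le> p"
    using card_q_greater_le[of "t r - 1"] s by linarith
  moreover have "{j. j \<in> {1..c} \<and> t j \<le> t r - 1} = {1..<r}"
  proof (intro set_eqI iffI)
    fix j assume j: "j \<in> {j. j \<in> {1..c} \<and> t j \<le> t r - 1}"
    have "\<not> r \<le> j"
    proof
      assume "r \<le> j"
      then have "t r \<le> t j" using t_less[of r j] j r by (cases "r = j") auto
      then show False using j tr by auto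
    qed
    then show "j \<in> {1..<r}" using j by auto
  next
    fix j assume "j \<in> {1..<r}"
    then show "j \<in> {j. j \<in> {1..c} \<and> t j \<le> t r - 1}" using t_less[of j r] r by auto
  qed
  then have "h (t r - 1 + 1) + (\<Sum>j | j \<in> {1..c} \<and> t j \<le> t r - 1. h (t j) - h (t (j + 1)))
      = h (t 1) + (\<Sum>i\<in>{}. \<alpha> (q i))"
    using t_telescope[OF r(1)] tr by simp
  ultimately have "tight ({1..t r - 1} \<union> q ` ({1..s} - {}))"
    using tr m_less_n by (intro tight_prefix) auto
  moreover have "{1..t r - 1} = {1..<t r}" by auto
  ultimately show ?thesis using S(1) by simp
qed

text \<open>
  Here \<open>y = h 1\<close> is feasible whatever \<open>z\<close> is, and \<open>j\<close> fits because \<open>S\<close> leaves capacity \<open>psum a m\<close>.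
\<close>

lemma tight_S_insert:
  assumes "h (t 1) = h 1" and j: "j \<in> {1..n}" "j \<notin> S" "j \<notin> t ` {1..c}"
  shows "tight (insert j S)"
proof -
  let ?U = "insert j S"
  have U: "?U \<subseteq> {1..n}" using j S(2) by auto
  have "sum a S = (\<Sum>i\<in>S. 1)" using a_S by (intro sum.cong) auto
  then have "sum a S = real s" using S(1) card_image[OF S(3)] by simp
  moreover have "a j \<le> psum a m" using a_not_S j by simp
  moreover have "finite S" using S(1) by simp
  ultimately have "sum a ?U \<le> p" using s j(2) by simp
  then have mem: "(h 1, ones ?U) \<in> Q"
    using h_decreasing[of 1] h_ge_0[of 1] n_pos by (subst point_mem[OF U]) auto
  have none: "{i. i \<in> {1..c} \<and> t i \<in> ?U} = {}"
    using t_mem_m S(2) j(3) by fastforce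
  have zeros: "zeros ?U = {}" using S(1) by (auto simp: zeros_def)
  have "left_side (h 1, ones ?U) = right_side"
    using left_minus_right[OF U, of "h 1"] assms(1) unfolding none zeros by simp
  then show ?thesis using U mem by (auto simp: tight_def)
qed

lemma tight_S:
  assumes "h (t 1) = h 1"
  shows "tight S"
proof -
  have "psum a 0 + real (card {i \<in> {1..s}. 0 < q i \<and> i \<notin> {}}) \<le> p"
    using card_q_greater_le[of 0] s psum_m_nonneg by (simp add: psum_def)
  moreover have none: "{j. j \<in> {1..c} \<and> t j \<le> 0} = {}" using t_mem_m by fastforce
  then have "h (0 + 1) + (\<Sum>j | j \<in> {1..c} \<and> t j \<le> 0. h (t j) - h (t (j + 1)))
      = h (t 1) + (\<Sum>i\<in>{}. \<alpha> (q i))"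
    unfolding none using assms by simp
  ultimately have "tight ({1..0} \<union> q ` ({1..s} - {}))"
    using n_pos by (intro tight_prefix) auto
  then show ?thesis using S(1) by simp
qed

text \<open>
  All \<open>i \<ge> j'\<close> have \<open>q i > K j'\<close>, so \<open>s - j'\<close> items of \<open>S\<close> remain beyond the prefix. They fit, since
  the weight of the prefix is at most \<open>psum a m + j'\<close>.
\<close>

lemma tight_lifted:
  assumes j: "j \<in> {1..s}" and j': "j' \<in> {1..j}"
    and attained: "\<alpha> (q j) + (\<Sum>i | i \<in> {1..<j'} \<and> q i > K j'. \<alpha> (q i)) = h (K j' + 1) - h (m + 1)"
  shows "tight ({1..K j'} \<union> q ` ({1..s} - insert j {i. i \<in> {1..<j'} \<and> q i > K j'}))"
proof (rule tight_prefix)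
  let ?I = "insert j {i. i \<in> {1..<j'} \<and> q i > K j'}"
  have qj: "K j' < q j" using q_gt[of j] K_mono[of j' j] j j' by auto
  have notin: "j \<notin> {i. i \<in> {1..<j'} \<and> q i > K j'}" using j' by auto
  show "K j' < n" using K_less j j' by auto
  show I: "?I \<subseteq> {1..s}" using j j' by auto
  show "K j' < q i" if "i \<in> ?I" for i using that qj by auto
  have "card {i \<in> {1..s}. K j' < q i \<and> i \<notin> ?I} \<le> s - j'"
  proof -
    have late: "K j' < q i" if "i \<in> {j'..s}" for i
      using q_gt[of i] K_mono[of j' i] that j' by auto
    have "{i \<in> {1..s}. K j' < q i \<and> i \<notin> ?I} = {j'..s} - {j}"
      using late j' by auto
    moreover have "card ({j'..s} - {j}) = s - j'"
      using j j' by (subst card_Diff_singleton) auto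
    ultimately show ?thesis by simp
  qed
  then have "real (card {i \<in> {1..s}. K j' < q i \<and> i \<notin> ?I}) \<le> real s - real j'"
    using j j' by (simp add: of_nat_diff le_diff_conv2 flip: of_nat_add) 
  then show "psum a (K j') + real (card {i \<in> {1..s}. K j' < q i \<and> i \<notin> ?I}) \<le> p"
    using psum_K_le[of j'] s by linarith
  have "{i. i \<in> {1..c} \<and> t i \<le> K j'} = {1..<c + 1}"
    using t_mem_m m_le_K[of j'] by fastforce
  then show "h (K j' + 1) + (\<Sum>i | i \<in> {1..c} \<and> t i \<le> K j'. h (t i) - h (t (i + 1)))
      = h (t 1) + (\<Sum>i\<in>?I. \<alpha> (q i))"
    using t_telescope[of "c + 1"] t_last attained notin by simp
qed

text \<open>
  The vectors are recovered in the order: items outside \<open>S \<union> T\<close>, items of \<open>T\<close> by comparing the prefixes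
  ending before consecutive elements of \<open>T\<close>, then the items \<open>q i\<close> by induction on \<open>i\<close>.
\<close>

lemma tight_differences_generate:
  fixes w :: "nat \<Rightarrow> 'v::real_vector"
  assumes V: "subspace V" and h1: "h (t 1) = h 1"
    and diff: "\<And>U U'. tight U \<Longrightarrow> tight U' \<Longrightarrow> sum w U - sum w U' \<in> V"
    and j: "j \<in> {1..n}"
  shows "w j \<in> V"
proof -
  have finS: "finite S" using S(1) by simp
  have free: "w j \<in> V" if "j \<in> {1..n}" "j \<notin> S" "j \<notin> t ` {1..c}" for j
    using diff[OF tight_S_insert[OF h1 that] tight_S[OF h1]] that finS by simp
  have in_T: "w (t r) \<in> V" if r: "r \<in> {1..c}" for r
  proof -
    let ?U = "{1..<t (r + 1)} \<union> S" and ?U' = "{1..<t r} \<union> S"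
    have less: "t r < t (r + 1)" using t_less[of r "r + 1"] r by auto
    have tr: "t r \<in> {1..m + 1}" "t (r + 1) \<in> {1..m + 1}" using t_mem[of r] t_mem[of "r + 1"] r by auto
    have "sum w ?U - sum w ?U' = sum w (?U - ?U')"
      using finS less by (subst sum_diff) auto
    also have "?U - ?U' = {t r..<t (r + 1)}" using tr S(2) by auto
    also have "\<dots> = insert (t r) {t r<..<t (r + 1)}" using less by auto
    also have "sum w \<dots> = w (t r) + sum w {t r<..<t (r + 1)}" by simp
    finally have "w (t r) + sum w {t r<..<t (r + 1)} \<in> V"
      using diff[OF tight_prefix_t[of "r + 1"] tight_prefix_t[of r]] r by simp
    moreover have "sum w {t r<..<t (r + 1)} \<in> V"
    proof (rule subspace_sum[OF V])
      fix i assume i: "i \<in> {t r<..<t (r + 1)}"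
      have "i \<notin> t ` {1..c}"
      proof
        assume "i \<in> t ` {1..c}"
        then obtain l where l: "l \<in> {1..c}" "i = t l" by blast
        show False
        proof (cases "l \<le> r")
          case True
          then have "t l \<le> t r" using t_less[of l r] l r by (cases "l = r") auto
          then show False using l i by auto
        next
          case False
          then have "t (r + 1) \<le> t l" using t_less[of "r + 1" l] l r by (cases "l = r + 1") auto
          then show False using l i by auto
        qed
      qed
      then show "w i \<in> V" using i tr S(2) m_less_n by (intro free) auto
    qed
    ultimately show ?thesis using subspace_diff[OF V] by fastforce
  qed
  have not_S: "w j \<in> V" if "j \<in> {1..n}" "j \<notin> S" for j
    using free in_T that by blast
  have in_S: "w (q i) \<in> V" if "i \<in> {1..s}" for i
    using that
  proof (induction i rule: less_induct)
    case (less i)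
    obtain i' where i': "i' \<in> {1..i}"
      "\<alpha> (q i) + (\<Sum>l | l \<in> {1..<i'} \<and> q l > K i'. \<alpha> (q l)) = h (K i' + 1) - h (m + 1)"
      using alpha_sum_attained less.prems by blast
    let ?L = "{l. l \<in> {1..<i'} \<and> q l > K i'}"
    let ?U = "{1..K i'} \<union> q ` ({1..s} - insert i ?L)"
    have qi: "K i' < q i" using q_gt[of i] K_mono[of i' i] less.prems i' by auto
    have sub: "insert i ?L \<subseteq> {1..s}" using less.prems i' by auto
    have "?U = ({1..K i'} - S) \<union> (S - q ` insert i ?L)"
    proof -
      have "q ` ({1..s} - insert i ?L) = S - q ` insert i ?L"
        using sub S(1,3) inj_on_image_set_diff[of q "{1..s}" "{1..s}" "insert i ?L"] by auto
      moreover have "{1..K i'} \<inter> q ` insert i ?L = {}" using qi by auto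
      ultimately show ?thesis by blast
    qed
    then have "sum w ?U = sum w ({1..K i'} - S) + sum w (S - q ` insert i ?L)"
      using finS by (simp only:) (intro sum.union_disjoint, auto)
    also have "sum w (S - q ` insert i ?L) = sum w S - sum w (q ` insert i ?L)"
      using finS sub S(1) by (intro sum_diff) auto
    finally have "sum w ({1..K i'} - S) - (sum w ?U - sum w S) = sum w (q ` insert i ?L)"
      by simp
    moreover have "sum w ?U - sum w S \<in> V"
      using diff[OF tight_lifted[OF less.prems i'] tight_S[OF h1]] .
    moreover have "sum w ({1..K i'} - S) \<in> V"
      using K_less[of i'] less.prems i' by (intro subspace_sum[OF V] not_S) auto
    ultimately have "sum w (q ` insert i ?L) \<in> V"
      using subspace_diff[OF V, of "sum w ({1..K i'} - S)" "sum w ?U - sum w S"] by (simp only:)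
    also have "sum w (q ` insert i ?L) = (\<Sum>l\<in>insert i ?L. w (q l))"
      unfolding sum.reindex[OF inj_on_subset[OF S(3) sub]] by (simp only: comp_def)
    also have "\<dots> = w (q i) + (\<Sum>l\<in>?L. w (q l))"
      using i' by (subst sum.insert) auto
    finally have "w (q i) + (\<Sum>l\<in>?L. w (q l)) \<in> V" .
    moreover have "(\<Sum>l\<in>?L. w (q l)) \<in> V"
      using less i' by (intro subspace_sum[OF V]) auto
    ultimately show ?case using subspace_diff[OF V] by fastforce
  qed
  show ?thesis using in_S not_S j S(1) by (cases "j \<in> S") auto
qed

lemma aff_dim_face:
  assumes h1: "h (t 1) = h 1"
  shows "aff_dim {x \<in> convex hull Q. left_side x = right_side} = int CARD('n)"
proof -
  let ?F = "{x \<in> convex hull Q. left_side x = right_side}"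
  define w where "w j = (- z_normal $ e j, axis (e j) 1 :: real ^ 'n)" for j
  have "tight S" using tight_S[OF h1] .
  then obtain y0 where x0: "(y0, ones S) \<in> ?F"
    unfolding tight_def using hull_subset[of Q convex] by blast
  let ?V = "span ((\<lambda>x. x - (y0, ones S)) ` ?F)"
  have tight_sum: "\<exists>x\<in>?F. x = (right_side, 0) + sum w U" if tU: "tight U" for U
  proof -
    obtain y where y: "(y, ones U) \<in> Q" "left_side (y, ones U) = right_side"
      using tU unfolding tight_def by blast
    have "(y, ones U) = (right_side, 0) + sum w U"
    proof (rule prod_eqI)
      have "z_normal \<bullet> ones U = (\<Sum>j\<in>U. z_normal $ e j)"
        by (simp add: ones_def inner_sum_right inner_axis)
      then show "fst (y, ones U) = fst ((right_side, 0) + sum w U)"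
        using y(2) by (simp add: left_side_inner fst_sum w_def sum_negf)
      show "snd (y, ones U) = snd ((right_side, 0) + sum w U)"
        by (simp add: snd_sum w_def ones_def)
    qed
    then show ?thesis using y hull_subset[of Q convex] by blast
  qed
  have "sum w U - sum w U' \<in> ?V" if tU: "tight U" "tight U'" for U U'
  proof -
    obtain x x' where x: "x \<in> ?F" "x = (right_side, 0) + sum w U"
      and x': "x' \<in> ?F" "x' = (right_side, 0) + sum w U'"
      using tight_sum[OF tU(1)] tight_sum[OF tU(2)] by blast
    have "(x - (y0, ones S)) - (x' - (y0, ones S)) \<in> ?V"
      using x(1) x'(1) by (intro span_diff span_base imageI)
    then show ?thesis by (simp add: x(2) x'(2))
  qed
  then have w: "w j \<in> ?V" if "j \<in> {1..n}" for j
    by (rule tight_differences_generate[OF subspace_span h1 _ that])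
  show ?thesis
  proof (rule aff_dim_hyperplane_generated)
    show "?F \<subseteq> {x. (1, z_normal) \<bullet> x = right_side}" by (auto simp: left_side_inner)
    show "(y0, ones S) \<in> ?F" by (fact x0)
    fix i
    obtain j where "j \<in> {1..n}" "i = e j"
      using e by (metis UNIV_I bij_betw_imp_surj_on imageE)
    then show "(- z_normal $ i, axis i 1) \<in> ?V" using w by (simp add: w_def)
  qed
qed

lemma aff_dim_face_less:
  assumes less: "h (t 1) < h 1"
  shows "aff_dim {x \<in> convex hull Q. left_side x = right_side} < int CARD('n)"
proof -
  let ?F = "{x \<in> convex hull Q. left_side x = right_side}"
  let ?d = "h 1 - h (t 1)"
  let ?A = "(1, z_normal) + (0, ?d *\<^sub>R axis (e 1) 1)"
  \<comment> \<open>This is the inequality for \<open>T\<close> with 1 added; it dominates the given one since \<open>z\<^sub>1 \<le> 1\<close>.\<close>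
  have "convex hull Q \<subseteq> {x. ?A \<bullet> x \<ge> right_side + ?d}"
  proof (rule hull_minimal)
    show "Q \<subseteq> {x. ?A \<bullet> x \<ge> right_side + ?d}"
    proof
      fix x assume x: "x \<in> Q"
      then obtain y U where U: "x = (y, ones U)" "U \<subseteq> {1..n}" by (rule mem_obtains_ones)
      have "?A \<bullet> x = left_side x + ?d * (if 1 \<in> U then 1 else 0)"
        using ones_nth[OF U(2), of 1] n_pos
        by (simp add: inner_add_left left_side_inner U inner_axis')
      then show "x \<in> {x. ?A \<bullet> x \<ge> right_side + ?d}"
        using right_le_left_point[of U y] first_zero_slack[of U y] x U by auto
    qed
  qed (rule convex_halfspace_ge)
  moreover have "convex hull Q \<subseteq> {x. (0, axis (e 1) 1) \<bullet> x \<le> 1}"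
  proof (rule hull_minimal)
    show "Q \<subseteq> {x. (0, axis (e 1) 1) \<bullet> x \<le> 1}"
      by (auto simp: mixing_knapsack_set_def inner_axis') (metis insert_iff order_refl zero_le_one singletonD)
  qed (rule convex_halfspace_le)
  ultimately have "?F \<subseteq> {x. (1, z_normal) \<bullet> x = right_side} \<inter> {x. (0, axis (e 1) 1) \<bullet> x = 1}"
    using less by (auto simp: left_side_inner inner_add_left inner_axis' subset_iff)
      (smt (verit) mult_left_le mult_le_cancel_left1)
  then have "aff_dim ?F \<le> aff_dim ({x. (1 :: real, z_normal) \<bullet> x = right_side} \<inter> {x. (0, axis (e 1) 1) \<bullet> x = 1})"
    by (rule aff_dim_subset)
  also have "\<dots> < int CARD('n)"
  proof -
    let ?H = "{x. (1 :: real, z_normal) \<bullet> x = right_side}"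
    have "aff_dim ?H = int CARD('n)"
      by (subst aff_dim_hyperplane) (auto simp: zero_prod_def)
    moreover have "(right_side, 0) \<in> ?H" "(right_side, 0) \<notin> {x. (0, axis (e 1) 1) \<bullet> x = (1::real)}"
      by auto
    ultimately show ?thesis
      by (subst aff_dim_affine_Int_hyperplane) (auto simp: affine_hyperplane simp del: mem_Collect_eq inner_Pair)
  qed
  finally show ?thesis .
qed

lemma facet_iff:
  "{x \<in> convex hull Q. left_side x = right_side} facet_of (convex hull Q) \<longleftrightarrow> h (t 1) = h 1"
proof -
  let ?F = "{x \<in> convex hull Q. left_side x = right_side}"
  have "?F = convex hull Q \<inter> {x. (1, z_normal) \<bullet> x = right_side}"
    by (auto simp: left_side_inner)
  then have face: "?F face_of (convex hull Q)"
    using right_le_left left_side_inner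
    by (simp only:) (intro face_of_Int_supporting_hyperplane_ge convex_convex_hull)
  have "h (t 1) \<le> h 1" using t_mem[of 1] m_less_n by (intro h_decreasing) auto
  moreover have "?F \<noteq> {}" if "aff_dim ?F = int CARD('n)"
    using that by force
  ultimately show ?thesis
    using face aff_dim_face aff_dim_face_less
    by (auto simp: facet_of_def aff_dim_convex_hull_Q less_le)
qed

end

theorem theorem7:
  fixes e :: "nat \<Rightarrow> 'n::finite" and n :: nat
    and h a :: "nat \<Rightarrow> real" and p :: real
    and m s c :: nat
    and t q :: "nat \<Rightarrow> nat" and T S :: "nat set"
    and \<alpha> :: "nat \<Rightarrow> real"
  assumes n: "n = CARD('n)"
    and e: "bij_betw e {1..n} UNIV"
    and h_decreasing: "\<And>i j. 1 \<le> i \<Longrightarrow> i \<le> j \<Longrightarrow> j \<le> n \<Longrightarrow> h j \<le> h i"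
    and h_nonneg: "0 \<le> h n"
    and a_nonneg: "\<And>j. j \<in> {1..n} \<Longrightarrow> 0 \<le> a j"
    and p_nonneg: "0 \<le> p"
    and a_le_p: "\<And>j. j \<in> {1..n} \<Longrightarrow> a j \<le> p"
    and sum_gt_p: "(\<Sum>j = 1..n. a j) > p"
    and m: "m \<le> nu n a p"
    and integral: "p - psum a m \<in> \<int>"
    and k0: "h (kidx n a m 0 + 1) = h (m + 1)"
    and T: "T = t ` {1..c}" "T \<subseteq> {1..m}" "strict_mono_on {1..c} t"
    and t_last: "t (c + 1) = m + 1"
    and s: "real s = p - psum a m"
    and S: "S = q ` {1..s}" "S \<subseteq> {m + 2..n}" "inj_on q {1..s}"
    and q_gt: "\<And>j. j \<in> {1..s} \<Longrightarrow> q j > kidx n a m j"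
    and a_S: "\<And>j. j \<in> S \<Longrightarrow> a j = 1"
    and a_not_S: "\<And>j. j \<in> {1..n} - S \<Longrightarrow> a j \<le> psum a m"
    and \<alpha>_first: "1 \<le> s \<Longrightarrow> \<alpha> (q 1) = h (kidx n a m 1 + 1) - h (m + 1)"
    and \<alpha>_next: "\<And>j. 2 \<le> j \<Longrightarrow> j \<le> s \<Longrightarrow>
      \<alpha> (q j) = min (\<alpha> (q (j - 1)))
        (h (kidx n a m j + 1) - h (m + 1)
          - (\<Sum>i | i \<in> {1..<j} \<and> q i > kidx n a m j. \<alpha> (q i)))"
  defines "P \<equiv> convex hull (mixing_knapsack_set e h a p)"
    and "lhs \<equiv> (\<lambda>(y, z). y + (\<Sum>j = 1..c. (h (t j) - h (t (j + 1))) * z $ e (t j))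
                 + (\<Sum>i \<in> S. \<alpha> i * z $ e i))"
    and "rhs \<equiv> h (t 1) + (\<Sum>i \<in> S. \<alpha> i)"
  shows "valid_ineq lhs rhs P \<and> (facet_defining lhs rhs P \<longleftrightarrow> h (t 1) = h 1)"
proof -
  interpret lifted_mixing n e h a p m s c t q S \<alpha>
    by unfold_locales (fact assms | use T in blast)+
  have "lhs = left_side" "rhs = right_side"
    unfolding lhs_def rhs_def left_side_def right_side_def by simp_all
  then show ?thesis
    using right_le_left facet_iff
    by (auto simp: P_def valid_ineq_def facet_defining_def)
qed

end
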